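(* Let $\alpha,\beta,\gamma$ be partitions. Then $N_1(\alpha,\beta,\gamma)\le N_B(\alpha,\beta,\gamma)$ and $N_1(\alpha,\beta,\gamma)\le N_V(\alpha,\beta,\gamma)$.
   Context: A partition is a finite weakly decreasing sequence of positive integers, extended by zeros when needed; $|\lambda|$ is the sum of its parts; $\bar\lambda=(\lambda_2,\lambda_3,\ldots)$; $\alpha\cap\beta=(\min(\alpha_1,\beta_1),\min(\alpha_2,\beta_2),\ldots)$. For partitions $\alpha,\beta,\gamma$ define $$M_1(\alpha,\beta;\gamma)=|\gamma|+|\bar\alpha\cap\bar\beta|+\alpha_1+\beta_1,\qquad M_B(\alpha,\beta;\gamma)=|\alpha|+|\beta|+\gamma_1,$$ $$M_V(\alpha,\beta;\gamma)=|\gamma|+\begin{cases}\max\{|\alpha|+\alpha_1-1,\ |\beta|+\beta_1-1,\ |\gamma|\} & \text{if }\alpha\ne\beta,\\ \max\{|\alpha|+\alpha_1,\ |\gamma|\} & \text{if }\alpha=\beta,\end{cases}$$ and, for $X\in\{1,B,V\}$, $$N_X(\alpha,\beta,\gamma)=\min\{M_X(\alpha,\beta;\gamma),\,M_X(\alpha,\gamma;\beta),\,M_X(\beta,\gamma;\alpha)\}.$$ *)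

theory Defs
  imports Main
begin

definition is_partition :: "nat list \<Rightarrow> bool" where
  "is_partition lam \<longleftrightarrow> sorted_wrt (\<ge>) lam \<and> (\<forall>x\<in>set lam. 0 < x)"

text \<open>Parts are numbered from 1, as usual for partitions; parts beyond the length are zero.\<close>

definition part :: "nat list \<Rightarrow> nat \<Rightarrow> nat" where
  "part lam i = (if 1 \<le> i \<and> i \<le> length lam then lam ! (i - 1) else 0)"

definition psize :: "nat list \<Rightarrow> nat" where
  "psize lam = sum_list lam"

definition pbar :: "nat list \<Rightarrow> nat list" where
  "pbar lam = tl lam"

text \<open>Cutting off at the shorter length loses nothing: beyond it one of the two parts is zero,
  and so is the minimum (lemma \<open>part_pcap\<close>).\<close>

definition pcap :: "nat list \<Rightarrow> nat list \<Rightarrow> nat list" where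
  "pcap a b = map2 min a b"

lemma part_pbar: "1 \<le> i \<Longrightarrow> part (pbar lam) i = part lam (Suc i)"
  by (cases lam) (auto simp: part_def pbar_def nth_Cons split: nat.split)

lemma part_pcap: "part (pcap a b) i = min (part a i) (part b i)"
proof (cases "1 \<le> i \<and> i \<le> length a \<and> i \<le> length b")
  case True
  then have "i - 1 < length a" "i - 1 < length b"
    by auto
  with True show ?thesis
    by (simp add: part_def pcap_def)
next
  case False
  then show ?thesis
    by (auto simp: part_def pcap_def)
qed

lemma is_partition_pbar: "is_partition lam \<Longrightarrow> is_partition (pbar lam)"
  by (cases lam) (auto simp: is_partition_def pbar_def)

lemma is_partition_pcap:
  assumes "is_partition a" and "is_partition b"
  shows "is_partition (pcap a b)"
proof -
  have "pcap a b ! j \<le> pcap a b ! i" if "i < j" "j < length (pcap a b)" for i j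
  proof -
    have "a ! j \<le> a ! i" "b ! j \<le> b ! i"
      using assms that by (simp_all add: is_partition_def pcap_def sorted_wrt_iff_nth_less)
    then show ?thesis
      using that min.mono by (simp add: pcap_def)
  qed
  moreover have "0 < x" if "x \<in> set (pcap a b)" for x
    using assms that set_zip_leftD set_zip_rightD by (fastforce simp: is_partition_def pcap_def)
  ultimately show ?thesis
    by (simp add: is_partition_def sorted_wrt_iff_nth_less)
qed

text \<open>The bounds are integers, since the terms \<open>|\<alpha>| + \<alpha>\<^sub>1 - 1\<close> in \<open>M_V\<close> are \<open>-1\<close> for the empty
  partition.  The third argument is the one written after the semicolon, as in
  \<open>M(\<alpha>, \<beta>; \<gamma>)\<close>.\<close>

definition M_1 :: "nat list \<Rightarrow> nat list \<Rightarrow> nat list \<Rightarrow> int" where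
  "M_1 \<alpha> \<beta> \<gamma> =
     int (psize \<gamma>) + int (psize (pcap (pbar \<alpha>) (pbar \<beta>))) + int (part \<alpha> 1) + int (part \<beta> 1)"

definition M_B :: "nat list \<Rightarrow> nat list \<Rightarrow> nat list \<Rightarrow> int" where
  "M_B \<alpha> \<beta> \<gamma> = int (psize \<alpha>) + int (psize \<beta>) + int (part \<gamma> 1)"

definition M_V :: "nat list \<Rightarrow> nat list \<Rightarrow> nat list \<Rightarrow> int" where
  "M_V \<alpha> \<beta> \<gamma> =
     int (psize \<gamma>) +
     (if \<alpha> \<noteq> \<beta>
      then Max {int (psize \<alpha>) + int (part \<alpha> 1) - 1, int (psize \<beta>) + int (part \<beta> 1) - 1, int (psize \<gamma>)}
      else Max {int (psize \<alpha>) + int (part \<alpha> 1), int (psize \<gamma>)})"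

definition N_of ::
  "(nat list \<Rightarrow> nat list \<Rightarrow> nat list \<Rightarrow> int) \<Rightarrow> nat list \<Rightarrow> nat list \<Rightarrow> nat list \<Rightarrow> int" where
  "N_of M \<alpha> \<beta> \<gamma> = Min {M \<alpha> \<beta> \<gamma>, M \<alpha> \<gamma> \<beta>, M \<beta> \<gamma> \<alpha>}"

definition N_1 :: "nat list \<Rightarrow> nat list \<Rightarrow> nat list \<Rightarrow> int" where
  "N_1 = N_of M_1"

definition N_B :: "nat list \<Rightarrow> nat list \<Rightarrow> nat list \<Rightarrow> int" where
  "N_B = N_of M_B"

definition N_V :: "nat list \<Rightarrow> nat list \<Rightarrow> nat list \<Rightarrow> int" where
  "N_V = N_of M_V"

end

theory Submission
  imports Defs
begin

text \<open>
  A partition splits into its first part and its tail, so \<open>|\<alpha>| = \<alpha>\<^sub>1 + |\<alpha>'|\<close> with \<open>\<alpha>'\<close> the tail.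
  Both inequalities then hold term by term and come from comparing \<open>|\<alpha>' \<inter> \<beta>'|\<close> with \<open>|\<alpha>'|\<close> and
  \<open>|\<beta>'|\<close>.

  For \<open>M_B\<close>, adding \<open>\<alpha>\<^sub>1\<close> to \<open>|\<alpha>' \<inter> \<beta>'| \<le> |\<alpha>'|\<close> gives
  \<open>M_1(\<alpha>, \<beta>; \<gamma>) \<le> |\<gamma>| + |\<alpha>| + \<beta>\<^sub>1 = M_B(\<alpha>, \<gamma>; \<beta>)\<close>.  As \<open>M_1\<close> is symmetric in its first
  two arguments, each of the three terms of \<open>N_B\<close> is bounded below by some term of \<open>N_1\<close>.

  For \<open>M_V\<close> even \<open>M_1(\<alpha>, \<beta>; \<gamma>) \<le> M_V(\<alpha>, \<beta>; \<gamma>)\<close>.  If \<open>\<alpha> = \<beta>\<close>, then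
  \<open>|\<alpha>' \<inter> \<alpha>'| + 2\<alpha>\<^sub>1 = |\<alpha>| + \<alpha>\<^sub>1\<close>.  If \<open>\<alpha> \<noteq> \<beta>\<close>, a unit has to be saved.  When
  \<open>\<alpha>\<^sub>1 < \<beta>\<^sub>1\<close>, bounding the intersection by \<open>|\<beta>'|\<close> leaves \<open>|\<beta>| + \<alpha>\<^sub>1 \<le> |\<beta>| + \<beta>\<^sub>1 - 1\<close>,
  and dually when \<open>\<beta>\<^sub>1 < \<alpha>\<^sub>1\<close>.  When \<open>\<alpha>\<^sub>1 = \<beta>\<^sub>1\<close>, the tails differ, so their intersection is
  strictly smaller than one of them (\<open>psize_pcap_less\<close>).
\<close>

lemma psize_eq_part_plus_pbar: "psize lam = part lam 1 + psize (pbar lam)"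
  by (cases lam) (auto simp: psize_def part_def pbar_def)

lemma pcap_commute: "pcap a b = pcap b a"
  unfolding pcap_def by (induction a b rule: list_induct2') (auto simp: min.commute)

lemma pcap_idem: "pcap a a = a"
  unfolding pcap_def by (induction a) auto

lemma psize_pcap_le_left: "psize (pcap a b) \<le> psize a"
proof (induction a b rule: list_induct2')
  case (4 x xs y ys)
  then show ?case
    using min.cobounded1[of x y] by (simp add: psize_def pcap_def)
qed (auto simp: psize_def pcap_def)

lemma psize_pcap_le_right: "psize (pcap a b) \<le> psize b"
  using psize_pcap_le_left[of b a] by (simp add: pcap_commute)

text \<open>
  Intersecting never enlarges a part, so if the total size survives on both sides then every part
  does.  Positivity of the parts rules out lists that differ only by trailing zeros.
\<close>

lemma eq_if_psize_pcap_eq: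
  assumes "is_partition a" and "is_partition b"
    and "psize (pcap a b) = psize a" and "psize (pcap a b) = psize b"
  shows "a = b"
  using assms
proof (induction a b rule: list_induct2')
  case (4 x xs y ys)
  have tails: "is_partition xs" "is_partition ys"
    using "4.prems"(1,2) by (auto simp: is_partition_def)
  have "min x y + psize (pcap xs ys) = x + psize xs"
    and "min x y + psize (pcap xs ys) = y + psize ys"
    using "4.prems"(3,4) by (simp_all add: psize_def pcap_def)
  then have "x = y" and "psize (pcap xs ys) = psize xs" and "psize (pcap xs ys) = psize ys"
    using psize_pcap_le_left[of xs ys] psize_pcap_le_right[of xs ys] by linarith+
  with "4.IH" tails show ?case
    by simp
qed (auto simp: is_partition_def psize_def pcap_def)

lemma psize_pcap_less:
  assumes "is_partition a" and "is_partition b" and "a \<noteq> b"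
  shows "psize (pcap a b) < psize a \<or> psize (pcap a b) < psize b"
  using eq_if_psize_pcap_eq[OF assms(1,2)] assms(3)
    psize_pcap_le_left[of a b] psize_pcap_le_right[of a b]
  by linarith

lemma partition_eqI:
  assumes "is_partition a" and "is_partition b"
    and "part a 1 = part b 1" and "pbar a = pbar b"
  shows "a = b"
  using assms by (cases a; cases b) (auto simp: is_partition_def part_def pbar_def)

lemma M_1_commute: "M_1 \<alpha> \<beta> \<gamma> = M_1 \<beta> \<alpha> \<gamma>"
  by (simp add: M_1_def pcap_commute)

text \<open>
  The roles are permuted: \<open>M_B(\<alpha>, \<gamma>; \<beta>)\<close> contains \<open>|\<gamma>|\<close> and \<open>\<beta>\<^sub>1\<close> just as
  \<open>M_1(\<alpha>, \<beta>; \<gamma>)\<close> does, and its remaining \<open>|\<alpha>|\<close> absorbs \<open>\<alpha>\<^sub>1\<close> and the intersection.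
\<close>

lemma M_1_le_M_B: "M_1 \<alpha> \<beta> \<gamma> \<le> M_B \<alpha> \<gamma> \<beta>"
  using psize_pcap_le_left[of "pbar \<alpha>" "pbar \<beta>"] psize_eq_part_plus_pbar[of \<alpha>]
  by (simp add: M_1_def M_B_def)

lemma M_1_le_M_V:
  assumes "is_partition \<alpha>" and "is_partition \<beta>"
  shows "M_1 \<alpha> \<beta> \<gamma> \<le> M_V \<alpha> \<beta> \<gamma>"
proof (cases "\<alpha> = \<beta>")
  case True
  then show ?thesis
    using psize_eq_part_plus_pbar[of \<alpha>] by (simp add: M_1_def M_V_def pcap_idem)
next
  case False
  let ?i = "psize (pcap (pbar \<alpha>) (pbar \<beta>))"
  have "?i + part \<alpha> 1 + part \<beta> 1 < psize \<alpha> + part \<alpha> 1 \<or>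
        ?i + part \<alpha> 1 + part \<beta> 1 < psize \<beta> + part \<beta> 1"
  proof (cases "part \<alpha> 1 = part \<beta> 1")
    case True
    with False have "pbar \<alpha> \<noteq> pbar \<beta>"
      using partition_eqI[OF assms] by blast
    then have "?i < psize (pbar \<alpha>) \<or> ?i < psize (pbar \<beta>)"
      using assms by (intro psize_pcap_less is_partition_pbar)
    with True show ?thesis
      using psize_eq_part_plus_pbar[of \<alpha>] psize_eq_part_plus_pbar[of \<beta>] by linarith
  next
    case False
    then show ?thesis
      using psize_pcap_le_left[of "pbar \<alpha>" "pbar \<beta>"] psize_pcap_le_right[of "pbar \<alpha>" "pbar \<beta>"]
        psize_eq_part_plus_pbar[of \<alpha>] psize_eq_part_plus_pbar[of \<beta>]
      by linarith
  qed
  with False show ?thesis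
    by (auto simp: M_1_def M_V_def)
qed

theorem proposition5p2:
  fixes \<alpha> \<beta> \<gamma> :: "nat list"
  assumes "is_partition \<alpha>" and "is_partition \<beta>" and "is_partition \<gamma>"
  shows "N_1 \<alpha> \<beta> \<gamma> \<le> N_B \<alpha> \<beta> \<gamma> \<and> N_1 \<alpha> \<beta> \<gamma> \<le> N_V \<alpha> \<beta> \<gamma>"
proof
  have "M_1 \<alpha> \<gamma> \<beta> \<le> M_B \<alpha> \<beta> \<gamma>" and "M_1 \<alpha> \<beta> \<gamma> \<le> M_B \<alpha> \<gamma> \<beta>"
    by (rule M_1_le_M_B)+
  moreover have "M_1 \<alpha> \<beta> \<gamma> \<le> M_B \<beta> \<gamma> \<alpha>"
    using M_1_le_M_B[of \<beta> \<alpha> \<gamma>] by (simp add: M_1_commute)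
  ultimately show "N_1 \<alpha> \<beta> \<gamma> \<le> N_B \<alpha> \<beta> \<gamma>"
    by (auto simp: N_1_def N_B_def N_of_def min_le_iff_disj)
  show "N_1 \<alpha> \<beta> \<gamma> \<le> N_V \<alpha> \<beta> \<gamma>"
    using M_1_le_M_V[OF assms(1,2), of \<gamma>] M_1_le_M_V[OF assms(1,3), of \<beta>]
      M_1_le_M_V[OF assms(2,3), of \<alpha>]
    by (auto simp: N_1_def N_V_def N_of_def min_le_iff_disj)
qed

end
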